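(* The e-projection with respect to $D_G$ and the m-projection with respect to $D_F$ are one operation in conjugate coordinates. By the identity $D_G(p\|q)=D_F(\nabla G(q)\|\nabla G(p))$, minimizing $$D_G(p\,\|\,p_0)$$ over $p\in\mathcal M(c)$ is equivalent to minimizing $$D_F\big(\nabla G(p_0)\,\|\,\nabla G(p)\big)$$ over the image $\nabla G(\mathcal M(c))$. Thus the same problem is read in the conjugate coordinate system with the argument order reversed. The labels e-projection and m-projection are exchanged by $G\leftrightarrow F$, and the single projection theorem (recalled in the context) covers both directions, its application to the conjugate generator $F$ (the conjugate version recalled in the context) giving the m-projection under the corresponding assumptions for $F$.
   Context: Let $(\Xi,\mathcal A,\mu)$ be a $\sigma$-finite measure space, $I\subseteq\mathbb R$ an open interval, $G\in C^2(I)$ strictly convex with $G''>0$, $I^*=G'(I)$, and $F(u)=\sup_{s\in I}\{us-G(s)\}$ its convex conjugate on $I^*$; write $\nabla G(p)=G'(p)$ and $\nabla F=(G')^{-1}$, applied pointwise. For a strictly convex generator $H$, $d_H(s,t)=H(s)-H(t)-H'(t)(s-t)$ and $D_H(p\|q)=\int_\Xi d_H(p(\xi),q(\xi))\,d\mu(\xi)$. Let $p_0:\Xi\to I$ be a reference, $T:\Xi\to\mathbb R^k$ a statistic, $c\in\mathbb R^k$, $\mathbb E_p[T]=\int_\Xi pT\,d\mu$, and $\mathcal M(c)=\{p:\Xi\to I:\mathbb E_p[T]=c,\ D_G(p\|p_0)<\infty\}$. A family is m-flat if it is affine in $p$ and e-flat if it is affine in $\theta=\nabla G(p)$. The e-projection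 minimizes $D_G(\cdot\|p_0)$ (first argument varies) over an m-flat set; the m-projection minimizes $D_G(p_0\|\cdot)$ (second argument varies) over an e-flat set. Projection theorem: assume (A1) $G\in C^2(I)$ is strictly convex with $G''>0$; (A2) $\mathcal M(c)\neq\emptyset$; (A3) the dual objective $\Phi(\lambda)=\langle\lambda,c\rangle-\int_\Xi F(\nabla G(p_0)+\langle\lambda,T\rangle)\,d\mu+\int_\Xi F(\nabla G(p_0))\,d\mu$ attains its supremum at a point of $\operatorname{ri}(\mathcal D)$ modulo $\mathcal N=\{a:\langle a,T\rangle=0\ \mu\text{-a.e.}\}$, where $\mathcal D=\{\lambda\in\mathbb R^k:\nabla G(p_0)+\langle\lambda,T\rangle\in I^*\ \mu\text{-a.e.},\ \int_\Xi F(\nabla G(p_0)+\langle\lambda,T\rangle)\,d\mu<\infty\}$, and $0\in\mathcal D$; (A4) differentiation under the integral sign is valid on $\operatorname{ri}(\mathcal D)$, so $\nabla\Phi(\lambda)=c-\mathbb E_{p^*_\lambda}[T]$ there, with $p^*_\lambda=\nabla F(\nabla G(p_0)+\langle\lambda,T\rangle)$. Then the minimization of $D_G(p\|p_0)$ over $\mathcal M(c)$ has a $\mu$-a.e. unique solution $p^*=\nabla F(\nabla G(p_0)+\langle\lambda,T\rangle)$, with $\lambda$ solving $\mathbb E_{p^*}[T]=c$ and unique modulo $\mathcal N$, and $D_G(p\|p_0)=D_G(p\|p^* )+D_G(p^*\|p_0)$ for all $p\in\mathcal M(c)$. Conjugate version: under the corresponding assumptions for the conjugate generator $F$, the m-projection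 $\min_{p\in\mathcal E}D_G(p_0\|p)$ onto an e-flat family $\mathcal E$ exists, is unique, has the conjugate solution form, and satisfies $D_G(p_0\|p)=D_G(p^*\|p)+D_G(p_0\|p^* )$; it is obtained by applying the projection theorem to $F$. *)

theory Defs
  imports "HOL-Analysis.Analysis"
begin

definition strictly_convex_on :: "real set \<Rightarrow> (real \<Rightarrow> real) \<Rightarrow> bool" where
  "strictly_convex_on J H \<longleftrightarrow> convex J \<and>
    (\<forall>x\<in>J. \<forall>y\<in>J. \<forall>t. x \<noteq> y \<longrightarrow> 0 < t \<longrightarrow> t < 1 \<longrightarrow>
      H ((1 - t) * x + t * y) < (1 - t) * H x + t * H y)"

(* The values of H outside J play no role: J is open, so deriv H and deriv (deriv H) on J
   depend on the restriction of H to J only. *)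
definition generator :: "real set \<Rightarrow> (real \<Rightarrow> real) \<Rightarrow> bool" where
  "generator J H \<longleftrightarrow> open J \<and> is_interval J \<and> J \<noteq> {} \<and>
    (\<forall>s\<in>J. H differentiable (at s)) \<and>
    (\<forall>s\<in>J. deriv H differentiable (at s)) \<and>
    continuous_on J (deriv (deriv H)) \<and>
    strictly_convex_on J H \<and>
    (\<forall>s\<in>J. deriv (deriv H) s > 0)"

definition dual_interval :: "real set \<Rightarrow> (real \<Rightarrow> real) \<Rightarrow> real set" where
  "dual_interval J H = deriv H ` J"

(* Only meaningful on dual_interval J H, where the supremum is finite for a generator H. *)
definition conjugate :: "real set \<Rightarrow> (real \<Rightarrow> real) \<Rightarrow> real \<Rightarrow> real" where
  "conjugate J H u = (SUP s\<in>J. u * s - H s)"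

definition conjugate_grad :: "real set \<Rightarrow> (real \<Rightarrow> real) \<Rightarrow> real \<Rightarrow> real" where
  "conjugate_grad J H = inv_into J (deriv H)"

definition breg :: "(real \<Rightarrow> real) \<Rightarrow> real \<Rightarrow> real \<Rightarrow> real" where
  "breg H s t = H s - H t - deriv H t * (s - t)"

(* The integrand is nonnegative whenever p and q take values in the domain of a convex H,
   so that the integral exists in [0, \<infinity>] and ennreal discards nothing. *)
definition bregman :: "'x measure \<Rightarrow> (real \<Rightarrow> real) \<Rightarrow> ('x \<Rightarrow> real) \<Rightarrow> ('x \<Rightarrow> real) \<Rightarrow> ennreal" where
  "bregman \<mu> H p q = (\<integral>\<^sup>+ \<xi>. ennreal (breg H (p \<xi>) (q \<xi>)) \<partial>\<mu>)"

(* Functions from the underlying space to J are represented by extensional functions, so that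
   two of them are equal iff they agree at every point of the space. *)
definition fields :: "'x measure \<Rightarrow> real set \<Rightarrow> ('x \<Rightarrow> real) set" where
  "fields \<mu> J = borel_measurable \<mu> \<inter> (space \<mu> \<rightarrow>\<^sub>E J)"

abbreviation grad :: "'x measure \<Rightarrow> (real \<Rightarrow> real) \<Rightarrow> ('x \<Rightarrow> real) \<Rightarrow> 'x \<Rightarrow> real" where
  "grad \<mu> H p \<equiv> compose (space \<mu>) (deriv H) p"

definition has_moment :: "'x measure \<Rightarrow> ('x \<Rightarrow> real ^ 'k) \<Rightarrow> ('x \<Rightarrow> real) \<Rightarrow> real ^ 'k \<Rightarrow> bool" where
  "has_moment \<mu> T p c \<longleftrightarrow>
    integrable \<mu> (\<lambda>\<xi>. p \<xi> *\<^sub>R T \<xi>) \<and> (\<integral>\<xi>. p \<xi> *\<^sub>R T \<xi> \<partial>\<mu>) = c"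

(* The set M(c), for the generator H on J and the reference q. *)
definition moment_family ::
  "'x measure \<Rightarrow> real set \<Rightarrow> (real \<Rightarrow> real) \<Rightarrow> ('x \<Rightarrow> real) \<Rightarrow> ('x \<Rightarrow> real ^ 'k) \<Rightarrow> real ^ 'k
    \<Rightarrow> ('x \<Rightarrow> real) set" where
  "moment_family \<mu> J H q T c = {p \<in> fields \<mu> J. has_moment \<mu> T p c \<and> bregman \<mu> H p q < \<infinity>}"

(* The same linear constraint imposed on the dual coordinate, and finiteness of the divergence
   with the reference in the first argument. *)
definition dual_moment_family ::
  "'x measure \<Rightarrow> real set \<Rightarrow> (real \<Rightarrow> real) \<Rightarrow> ('x \<Rightarrow> real) \<Rightarrow> ('x \<Rightarrow> real ^ 'k) \<Rightarrow> real ^ 'k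
    \<Rightarrow> ('x \<Rightarrow> real) set" where
  "dual_moment_family \<mu> J H q T c =
    {p \<in> fields \<mu> J. has_moment \<mu> T (grad \<mu> H p) c \<and> bregman \<mu> H q p < \<infinity>}"

definition affine_class :: "'x measure \<Rightarrow> ('x \<Rightarrow> real) set \<Rightarrow> bool" where
  "affine_class \<mu> A \<longleftrightarrow>
    (\<forall>f\<in>A. \<forall>g\<in>A. \<forall>t::real. (\<lambda>\<xi>\<in>space \<mu>. (1 - t) * f \<xi> + t * g \<xi>) \<in> A)"

(* Flatness is relative to an ambient class X of admissible functions: a flat family is the part
   of X cut out by an affine set of functions, in the coordinate p or in the coordinate grad p.
   An ambient class is needed because the admissible functions (values in an interval, possibly
   finite divergence to a reference) do not form an affine set themselves. *)
definition m_flat :: "'x measure \<Rightarrow> ('x \<Rightarrow> real) set \<Rightarrow> ('x \<Rightarrow> real) set \<Rightarrow> bool" where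
  "m_flat \<mu> X S \<longleftrightarrow> (\<exists>A. affine_class \<mu> A \<and> S = {p \<in> X. p \<in> A})"

definition e_flat ::
  "'x measure \<Rightarrow> (real \<Rightarrow> real) \<Rightarrow> ('x \<Rightarrow> real) set \<Rightarrow> ('x \<Rightarrow> real) set \<Rightarrow> bool" where
  "e_flat \<mu> H X S \<longleftrightarrow> (\<exists>A. affine_class \<mu> A \<and> S = {p \<in> X. grad \<mu> H p \<in> A})"

definition e_projection ::
  "'x measure \<Rightarrow> (real \<Rightarrow> real) \<Rightarrow> ('x \<Rightarrow> real) set \<Rightarrow> ('x \<Rightarrow> real) \<Rightarrow> ('x \<Rightarrow> real) set
    \<Rightarrow> ('x \<Rightarrow> real) \<Rightarrow> bool" where
  "e_projection \<mu> H X q S p \<longleftrightarrow>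
    m_flat \<mu> X S \<and> is_arg_min (\<lambda>r. bregman \<mu> H r q) (\<lambda>r. r \<in> S) p"

definition m_projection ::
  "'x measure \<Rightarrow> (real \<Rightarrow> real) \<Rightarrow> ('x \<Rightarrow> real) set \<Rightarrow> ('x \<Rightarrow> real) \<Rightarrow> ('x \<Rightarrow> real) set
    \<Rightarrow> ('x \<Rightarrow> real) \<Rightarrow> bool" where
  "m_projection \<mu> H X q S p \<longleftrightarrow>
    e_flat \<mu> H X S \<and> is_arg_min (\<lambda>r. bregman \<mu> H q r) (\<lambda>r. r \<in> S) p"

definition null_directions :: "'x measure \<Rightarrow> ('x \<Rightarrow> real ^ 'k) \<Rightarrow> (real ^ 'k) set" where
  "null_directions \<mu> T = {a. AE \<xi> in \<mu>. a \<bullet> T \<xi> = 0}"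

definition tilt ::
  "(real \<Rightarrow> real) \<Rightarrow> ('x \<Rightarrow> real) \<Rightarrow> ('x \<Rightarrow> real ^ 'k) \<Rightarrow> real ^ 'k \<Rightarrow> 'x \<Rightarrow> real" where
  "tilt H q T l \<xi> = deriv H (q \<xi>) + l \<bullet> T \<xi>"

definition tilted ::
  "real set \<Rightarrow> (real \<Rightarrow> real) \<Rightarrow> ('x \<Rightarrow> real) \<Rightarrow> ('x \<Rightarrow> real ^ 'k) \<Rightarrow> real ^ 'k \<Rightarrow> 'x \<Rightarrow> real" where
  "tilted J H q T l \<xi> = conjugate_grad J H (tilt H q T l \<xi>)"

(* Finiteness of the integral is read as integrability. *)
definition dual_params ::
  "'x measure \<Rightarrow> real set \<Rightarrow> (real \<Rightarrow> real) \<Rightarrow> ('x \<Rightarrow> real) \<Rightarrow> ('x \<Rightarrow> real ^ 'k)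
    \<Rightarrow> (real ^ 'k) set" where
  "dual_params \<mu> J H q T =
    {l. (AE \<xi> in \<mu>. tilt H q T l \<xi> \<in> dual_interval J H) \<and>
        integrable \<mu> (\<lambda>\<xi>. conjugate J H (tilt H q T l \<xi>))}"

definition dual_objective ::
  "'x measure \<Rightarrow> real set \<Rightarrow> (real \<Rightarrow> real) \<Rightarrow> ('x \<Rightarrow> real) \<Rightarrow> ('x \<Rightarrow> real ^ 'k) \<Rightarrow> real ^ 'k
    \<Rightarrow> real ^ 'k \<Rightarrow> real" where
  "dual_objective \<mu> J H q T c l =
    l \<bullet> c - (\<integral>\<xi>. conjugate J H (tilt H q T l \<xi>) \<partial>\<mu>)
          + (\<integral>\<xi>. conjugate J H (deriv H (q \<xi>)) \<partial>\<mu>)"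

(* The hypotheses of the projection theorem, for an arbitrary generator.  The dual objective is
   minus infinity off dual_params, so its supremum is taken over dual_params and having a gradient
   at l includes that l is an interior point of dual_params; without that clause GDERIV would see
   the meaningless values of dual_objective outside dual_params.  (dual_params is invariant under
   null_directions, so degenerate statistics are not excluded by this.) *)
definition projection_assumptions ::
  "'x measure \<Rightarrow> real set \<Rightarrow> (real \<Rightarrow> real) \<Rightarrow> ('x \<Rightarrow> real) \<Rightarrow> ('x \<Rightarrow> real ^ 'k) \<Rightarrow> real ^ 'k
    \<Rightarrow> bool" where
  "projection_assumptions \<mu> J H q T c \<longleftrightarrow>
    generator J H \<and>
    moment_family \<mu> J H q T c \<noteq> {} \<and>
    0 \<in> dual_params \<mu> J H q T \<and>
    (\<exists>l\<in>dual_params \<mu> J H q T.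
       (\<exists>a\<in>null_directions \<mu> T. l + a \<in> rel_interior (dual_params \<mu> J H q T)) \<and>
       (\<forall>l'\<in>dual_params \<mu> J H q T.
          dual_objective \<mu> J H q T c l' \<le> dual_objective \<mu> J H q T c l)) \<and>
    (\<forall>l\<in>rel_interior (dual_params \<mu> J H q T).
       l \<in> interior (dual_params \<mu> J H q T) \<and>
       integrable \<mu> (\<lambda>\<xi>. tilted J H q T l \<xi> *\<^sub>R T \<xi>) \<and>
       GDERIV (dual_objective \<mu> J H q T c) l :> (c - (\<integral>\<xi>. tilted J H q T l \<xi> *\<^sub>R T \<xi> \<partial>\<mu>)))"

(* The conclusion of the projection theorem, for an arbitrary generator. *)
definition e_projection_solution ::
  "'x measure \<Rightarrow> real set \<Rightarrow> (real \<Rightarrow> real) \<Rightarrow> ('x \<Rightarrow> real) \<Rightarrow> ('x \<Rightarrow> real ^ 'k) \<Rightarrow> real ^ 'k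
    \<Rightarrow> ('x \<Rightarrow> real) \<Rightarrow> real ^ 'k \<Rightarrow> bool" where
  "e_projection_solution \<mu> J H q T c p l \<longleftrightarrow>
    (let M = moment_family \<mu> J H q T c; X = {r \<in> fields \<mu> J. bregman \<mu> H r q < \<infinity>} in
      e_projection \<mu> H X q M p \<and>
      (\<forall>r. e_projection \<mu> H X q M r \<longrightarrow> (AE \<xi> in \<mu>. r \<xi> = p \<xi>)) \<and>
      l \<in> dual_params \<mu> J H q T \<and>
      (AE \<xi> in \<mu>. p \<xi> = tilted J H q T l \<xi>) \<and>
      has_moment \<mu> T p c \<and>
      (\<forall>l'. (AE \<xi> in \<mu>. tilt H q T l' \<xi> \<in> dual_interval J H) \<and>
            has_moment \<mu> T (tilted J H q T l') c \<longrightarrow> l' - l \<in> null_directions \<mu> T) \<and>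
      (\<forall>r\<in>M. bregman \<mu> H r q = bregman \<mu> H r p + bregman \<mu> H p q))"

(* The conjugate version.  In the coordinate p the solution is affine in the multiplier: the
   conjugate generator has gradient map inverse to deriv H, so its tilt of grad q is q + <l, T>. *)
definition m_projection_solution ::
  "'x measure \<Rightarrow> real set \<Rightarrow> (real \<Rightarrow> real) \<Rightarrow> ('x \<Rightarrow> real) \<Rightarrow> ('x \<Rightarrow> real ^ 'k) \<Rightarrow> real ^ 'k
    \<Rightarrow> ('x \<Rightarrow> real) \<Rightarrow> real ^ 'k \<Rightarrow> bool" where
  "m_projection_solution \<mu> J H q T c p l \<longleftrightarrow>
    (let E = dual_moment_family \<mu> J H q T c; X = {r \<in> fields \<mu> J. bregman \<mu> H q r < \<infinity>} in
      m_projection \<mu> H X q E p \<and>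
      (\<forall>r. m_projection \<mu> H X q E r \<longrightarrow> (AE \<xi> in \<mu>. r \<xi> = p \<xi>)) \<and>
      (AE \<xi> in \<mu>. p \<xi> = q \<xi> + l \<bullet> T \<xi>) \<and>
      has_moment \<mu> T (grad \<mu> H p) c \<and>
      (\<forall>l'. (AE \<xi> in \<mu>. q \<xi> + l' \<bullet> T \<xi> \<in> J) \<and>
            has_moment \<mu> T (\<lambda>\<xi>. deriv H (q \<xi> + l' \<bullet> T \<xi>)) c \<longrightarrow> l' - l \<in> null_directions \<mu> T) \<and>
      (\<forall>r\<in>E. bregman \<mu> H q r = bregman \<mu> H p r + bregman \<mu> H q p))"

end

theory Submission
  imports Defs
begin

text \<open>The derivative of a generator \<^term>\<open>G\<close> is an increasing bijection onto an open interval, its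
  inverse is the derivative of the conjugate, and the Fenchel identity turns the divergence of
  \<^term>\<open>G\<close> into that of its conjugate with the arguments swapped; so the pointwise gradient map
  carries flat families, minimizers and moment families into each other.  For the projection theorem,
  the gradient of the dual objective vanishes at the maximizer, so the tilted density there satisfies
  the moment constraint; the cross term of the three-point identity then integrates to zero, and the
  resulting Pythagorean identity gives minimality and uniqueness.\<close>

section \<open>Auxiliary facts on convexity, moments and minimizers\<close>

text \<open>Adding the divergences from \<open>x\<close> and \<open>y\<close> to \<open>z\<close>
  with weights \<open>1 - t\<close> and \<open>t\<close> cancels the derivative terms, as the
  weighted displacements sum to zero. Strict convexity of the conjugate is obtained in this
  way.\<close>

lemma strictly_convex_on_if_breg_pos:
  assumes "convex J" and "\<And>s t. s \<in> J \<Longrightarrow> t \<in> J \<Longrightarrow> s \<noteq> t \<Longrightarrow> breg H s t > 0"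
  shows "strictly_convex_on J H"
  unfolding strictly_convex_on_def
proof (intro conjI ballI allI impI)
  fix x y t :: real
  assume x: "x \<in> J" and y: "y \<in> J" and ne: "x \<noteq> y" and t: "0 < t" "t < 1"
  define z where "z = (1 - t) * x + t * y"
  have z: "z \<in> J"
    using convexD_alt[OF assms(1) x y, of t] t by (simp add: z_def)
  have dx: "x - z = t * (x - y)" and dy: "y - z = (1 - t) * (y - x)"
    by (simp_all add: z_def algebra_simps)
  have "x \<noteq> z" "y \<noteq> z" using dx dy ne t by auto
  then have "breg H x z > 0" "breg H y z > 0" using assms(2) x y z by auto
  then have "(1 - t) * breg H x z + t * breg H y z > 0"
    using t by (intro add_pos_pos mult_pos_pos) auto
  moreover have "(1 - t) * breg H x z + t * breg H y z = (1 - t) * H x + t * H y - H z"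
    unfolding breg_def dx dy by (simp add: algebra_simps)
  ultimately show "H ((1 - t) * x + t * y) < (1 - t) * H x + t * H y"
    by (simp add: z_def)
qed (rule assms(1))

text \<open>\<open>f\<close> is controlled only on \<open>J\<close>, so it is replaced by its
  extension by \<open>0\<close>, which is Borel and agrees with \<open>f\<close> along
  \<open>p\<close>.\<close>

lemma measurable_continuous_compose_fields:
  fixes f :: "real \<Rightarrow> real"
  assumes "open J" "continuous_on J f" "p \<in> fields \<mu> J"
  shows "(\<lambda>\<xi>. f (p \<xi>)) \<in> borel_measurable \<mu>"
proof -
  have "(\<lambda>x. if x \<in> J then f x else 0) \<in> borel_measurable borel"
    using assms by (intro borel_measurable_continuous_on_if) auto
  moreover have p: "p \<in> borel_measurable \<mu>" using assms(3) by (simp add: fields_def)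
  ultimately have "(\<lambda>\<xi>. if p \<xi> \<in> J then f (p \<xi>) else 0) \<in> borel_measurable \<mu>"
    using measurable_compose by blast
  then show ?thesis
    by (rule measurable_cong[THEN iffD1, rotated]) (use assms(3) in \<open>auto simp: fields_def\<close>)
qed

text \<open>Measurability of both functions is assumed because the measure need not be
  complete.\<close>

lemma has_moment_cong_AE:
  assumes p: "p \<in> borel_measurable \<mu>" and r: "r \<in> borel_measurable \<mu>"
    and T: "T \<in> borel_measurable \<mu>" and eq: "AE \<xi> in \<mu>. p \<xi> = r \<xi>"
  shows "has_moment \<mu> T p c \<longleftrightarrow> has_moment \<mu> T r c"
proof -
  have AE: "AE \<xi> in \<mu>. p \<xi> *\<^sub>R T \<xi> = r \<xi> *\<^sub>R T \<xi>" using eq by eventually_elim simp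
  note m = borel_measurable_scaleR[OF p T] borel_measurable_scaleR[OF r T]
  show ?thesis
    unfolding has_moment_def integrable_cong_AE[OF m AE] integral_cong_AE[OF m AE] ..
qed

lemma has_moment_cong:
  assumes "\<And>\<xi>. \<xi> \<in> space \<mu> \<Longrightarrow> p \<xi> = r \<xi>"
  shows "has_moment \<mu> T p c \<longleftrightarrow> has_moment \<mu> T r c"
proof -
  have "integrable \<mu> (\<lambda>\<xi>. p \<xi> *\<^sub>R T \<xi>) \<longleftrightarrow> integrable \<mu> (\<lambda>\<xi>. r \<xi> *\<^sub>R T \<xi>)"
    by (rule Bochner_Integration.integrable_cong) (auto simp: assms)
  moreover have "(\<integral>\<xi>. p \<xi> *\<^sub>R T \<xi> \<partial>\<mu>) = (\<integral>\<xi>. r \<xi> *\<^sub>R T \<xi> \<partial>\<mu>)"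
    by (rule Bochner_Integration.integral_cong) (auto simp: assms)
  ultimately show ?thesis by (simp add: has_moment_def)
qed

text \<open>The weights sum to one, so the moment \<open>c\<close> is preserved. This class
  witnesses flatness of both constraint families.\<close>

lemma has_moment_affine_class: "affine_class \<mu> {f. has_moment \<mu> T f c}"
  unfolding affine_class_def
proof (intro ballI allI CollectI)
  fix f g t assume "f \<in> {f. has_moment \<mu> T f c}" "g \<in> {f. has_moment \<mu> T f c}"
  then have f: "has_moment \<mu> T f c" and g: "has_moment \<mu> T g c" by auto
  have "has_moment \<mu> T (\<lambda>\<xi>. (1 - t) * f \<xi> + t * g \<xi>) c"
    using f g unfolding has_moment_def
    by (simp add: scaleR_add_left flip: scaleR_scaleR)
  then show "has_moment \<mu> T (\<lambda>\<xi>\<in>space \<mu>. (1 - t) * f \<xi> + t * g \<xi>) c"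
    by (subst has_moment_cong) auto
qed

lemma has_moment_inner:
  assumes "has_moment \<mu> T p c"
  shows "integrable \<mu> (\<lambda>\<xi>. p \<xi> * (a \<bullet> T \<xi>))" "(\<integral>\<xi>. p \<xi> * (a \<bullet> T \<xi>) \<partial>\<mu>) = a \<bullet> c"
proof -
  have i: "integrable \<mu> (\<lambda>\<xi>. p \<xi> *\<^sub>R T \<xi>)" and c: "(\<integral>\<xi>. p \<xi> *\<^sub>R T \<xi> \<partial>\<mu>) = c"
    using assms by (auto simp: has_moment_def)
  show "integrable \<mu> (\<lambda>\<xi>. p \<xi> * (a \<bullet> T \<xi>))"
    using integrable_inner_right[of a, OF i] by simp
  show "(\<integral>\<xi>. p \<xi> * (a \<bullet> T \<xi>) \<partial>\<mu>) = a \<bullet> c"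
    using integral_inner_right[of a, OF i] c by simp
qed

text \<open>Injectivity is required on all of \<open>X\<close>, since \<open>p\<close> may lie
  outside \<open>S\<close> and then \<open>g p\<close> must lie outside the image of
  \<open>S\<close>.\<close>

lemma is_arg_min_image:
  assumes "inj_on g X" "S \<subseteq> X" "p \<in> X" and "\<And>r. r \<in> S \<Longrightarrow> f' (g r) = f r"
  shows "is_arg_min f (\<lambda>r. r \<in> S) p \<longleftrightarrow> is_arg_min f' (\<lambda>y. y \<in> g ` S) (g p)"
proof (cases "p \<in> S")
  case True
  then show ?thesis using assms(4) by (simp add: is_arg_min_def) blast
next
  case False
  then show ?thesis
    using inj_on_image_mem_iff[OF assms(1,3,2)] by (simp add: is_arg_min_def)
qed

text \<open>Densities with equal moments differ by a function orthogonal to every component of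
  \<open>T\<close>; both the Pythagorean identity and the uniqueness of the multiplier rest on
  this.\<close>

lemma has_moment_diff:
  assumes "has_moment \<mu> T p c" "has_moment \<mu> T r c"
  shows "integrable \<mu> (\<lambda>\<xi>. (r \<xi> - p \<xi>) * (a \<bullet> T \<xi>))"
    "(\<integral>\<xi>. (r \<xi> - p \<xi>) * (a \<bullet> T \<xi>) \<partial>\<mu>) = 0"
  using has_moment_inner[OF assms(1), of a] has_moment_inner[OF assms(2), of a]
  by (auto simp: left_diff_distrib)

lemma null_direction_inner_moment:
  assumes "T \<in> borel_measurable \<mu>" "has_moment \<mu> T p c" "a \<in> null_directions \<mu> T"
  shows "a \<bullet> c = 0"
proof -
  have "AE \<xi> in \<mu>. p \<xi> * (a \<bullet> T \<xi>) = 0"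
    using assms(3) unfolding null_directions_def by (auto elim: eventually_mono)
  then have "(\<integral>\<xi>. p \<xi> * (a \<bullet> T \<xi>) \<partial>\<mu>) = 0" by (rule integral_eq_zero_AE)
  then show ?thesis using has_moment_inner(2)[OF assms(2)] by simp
qed

lemma moment_family_m_flat:
  "m_flat \<mu> {p \<in> fields \<mu> J. bregman \<mu> H p q < \<infinity>} (moment_family \<mu> J H q T c)"
  unfolding m_flat_def
  by (rule exI[of _ "{f. has_moment \<mu> T f c}"])
    (auto simp: has_moment_affine_class moment_family_def)

lemma dual_moment_family_e_flat:
  "e_flat \<mu> H {p \<in> fields \<mu> J. bregman \<mu> H q p < \<infinity>} (dual_moment_family \<mu> J H q T c)"
  unfolding e_flat_def
  by (rule exI[of _ "{f. has_moment \<mu> T f c}"])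
    (auto simp: has_moment_affine_class dual_moment_family_def)

text \<open>A finite \<open>b\<close> can be cancelled; this turns the Pythagorean identity for a
  second minimizer into a vanishing divergence.\<close>

lemma ennreal_add_le_imp_eq_0:
  fixes a b :: ennreal
  assumes "a + b \<le> b" "b < \<infinity>" shows "a = 0"
  using assms ennreal_add_left_cancel_le[of b a 0] by (auto simp: add.commute)

subsection \<open>Conjugation of generators\<close>

locale convex_generator =
  fixes J :: "real set" and H :: "real \<Rightarrow> real"
  assumes gen: "generator J H"
begin

lemma generator_open: "open J" and generator_convex: "convex J"
  using gen by (auto simp: generator_def is_interval_convex_1)

lemma generator_between:
  assumes "a \<in> J" "b \<in> J" "a \<le> x" "x \<le> b" shows "x \<in> J"
  by (rule mem_is_interval_1_I[OF _ assms]) (use gen in \<open>simp add: generator_def\<close>)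

lemma generator_DERIV: "s \<in> J \<Longrightarrow> DERIV H s :> deriv H s"
  and generator_DERIV_deriv: "s \<in> J \<Longrightarrow> DERIV (deriv H) s :> deriv (deriv H) s"
  and generator_deriv2_pos: "s \<in> J \<Longrightarrow> deriv (deriv H) s > 0"
  using gen by (auto simp: generator_def DERIV_deriv_iff_real_differentiable)

lemma generator_continuous: "continuous_on J H"
  and generator_deriv_continuous: "continuous_on J (deriv H)"
  by (rule DERIV_continuous_on, rule has_field_derivative_at_within,
      erule generator_DERIV generator_DERIV_deriv)+

lemma deriv_strict_mono:
  assumes "s \<in> J" "t \<in> J" "s < t" shows "deriv H s < deriv H t"
proof (rule DERIV_pos_imp_increasing[OF assms(3)])
  fix x assume "s \<le> x" "x \<le> t"
  then have "x \<in> J" using generator_between assms by blast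
  then show "\<exists>y. DERIV (deriv H) x :> y \<and> 0 < y"
    using generator_DERIV_deriv generator_deriv2_pos by blast
qed

lemma deriv_inj_on: "inj_on (deriv H) J"
proof (rule inj_onI, rule ccontr)
  fix s t assume "s \<in> J" "t \<in> J" "deriv H s = deriv H t" "s \<noteq> t"
  then show False
    using deriv_strict_mono[of s t] deriv_strict_mono[of t s] by (cases "s < t") auto
qed

lemma deriv_monotone_pos:
  assumes "s \<in> J" "t \<in> J" "s \<noteq> t" shows "(deriv H s - deriv H t) * (s - t) > 0"
  using deriv_strict_mono assms by (cases "s < t") (auto simp: mult_neg_neg)

text \<open>The mean value theorem writes the divergence as
  \<open>(deriv H z - deriv H t) * (s - t)\<close> with \<open>z\<close> strictly between the
  points, and \<open>deriv H\<close> is strictly increasing.\<close>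

lemma breg_pos:
  assumes s: "s \<in> J" and t: "t \<in> J" and ne: "s \<noteq> t" shows "breg H s t > 0"
proof -
  have mvt: "\<exists>z\<in>J. a < z \<and> z < b \<and> H b - H a = (b - a) * deriv H z"
    if "a \<in> J" "b \<in> J" "a < b" for a b
    using MVT2[OF \<open>a < b\<close>, of H "deriv H"] generator_DERIV generator_between[OF that(1,2)]
    by (metis less_imp_le)
  show ?thesis
  proof (cases "t < s")
    case True
    then obtain z where z: "z \<in> J" "t < z" "H s - H t = (s - t) * deriv H z"
      using mvt[OF t s] by blast
    then have "breg H s t = (deriv H z - deriv H t) * (s - t)"
      by (simp add: breg_def algebra_simps)
    then show ?thesis using deriv_strict_mono[OF t z(1,2)] True by simp
  next
    case False
    then have "s < t" using ne by simp
    then obtain z where z: "z \<in> J" "z < t" "H t - H s = (t - s) * deriv H z"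
      using mvt[OF s t] by blast
    then have "breg H s t = (deriv H t - deriv H z) * (t - s)"
      by (simp add: breg_def algebra_simps)
    then show ?thesis using deriv_strict_mono[OF z(1) t z(2)] \<open>s < t\<close> by simp
  qed
qed

lemma breg_nonneg: "s \<in> J \<Longrightarrow> t \<in> J \<Longrightarrow> breg H s t \<ge> 0"
  using breg_pos[of s t] by (cases "s = t") (auto simp: breg_def)

text \<open>The supremum is attained at \<open>s\<close>: the value there exceeds the value at
  \<open>t\<close> by \<open>breg H t s\<close>, which is nonnegative.\<close>

lemma conjugate_deriv:
  assumes "s \<in> J" shows "conjugate J H (deriv H s) = deriv H s * s - H s"
  unfolding conjugate_def
proof (rule cSup_eq_maximum)
  show "deriv H s * s - H s \<in> (\<lambda>t. deriv H s * t - H t) ` J" using assms by auto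
next
  fix y assume "y \<in> (\<lambda>t. deriv H s * t - H t) ` J"
  then obtain t where t: "t \<in> J" "y = deriv H s * t - H t" by auto
  show "y \<le> deriv H s * s - H s"
    using breg_nonneg[OF t(1) assms] t(2) by (simp add: breg_def algebra_simps)
qed

lemma conjugate_grad_deriv: "s \<in> J \<Longrightarrow> conjugate_grad J H (deriv H s) = s"
  by (simp add: conjugate_grad_def deriv_inj_on)

lemma conjugate_grad_mem: "u \<in> dual_interval J H \<Longrightarrow> conjugate_grad J H u \<in> J"
  and deriv_conjugate_grad: "u \<in> dual_interval J H \<Longrightarrow> deriv H (conjugate_grad J H u) = u"
  by (auto simp: dual_interval_def conjugate_grad_deriv)

lemma dual_interval_open: "open (dual_interval J H)"
  unfolding dual_interval_def
  by (rule invariance_of_domain[OF generator_deriv_continuous generator_open deriv_inj_on])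

lemma conjugate_grad_DERIV:
  assumes "u \<in> dual_interval J H"
  shows "DERIV (conjugate_grad J H) u :> inverse (deriv (deriv H) (conjugate_grad J H u))"
proof -
  let ?s = "conjugate_grad J H u"
  have s: "?s \<in> J" "deriv H ?s = u"
    using conjugate_grad_mem deriv_conjugate_grad assms by auto
  \<comment> \<open>The base point is kept in the form \<open>deriv H ?s\<close> to match the
    inverse function theorem.\<close>
  have "DERIV (conjugate_grad J H) (deriv H ?s) :> inverse (deriv (deriv H) ?s)"
    unfolding has_field_derivative_def
  proof (rule has_derivative_inverse_strong[OF generator_open s(1) generator_deriv_continuous])
    show "(deriv H has_derivative (*) (deriv (deriv H) ?s)) (at ?s)"
      using generator_DERIV_deriv[OF s(1)] by (simp add: has_field_derivative_def)
    show "(*) (deriv (deriv H) ?s) \<circ> (*) (inverse (deriv (deriv H) ?s)) = id"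
      using generator_deriv2_pos[OF s(1)] by (auto simp: fun_eq_iff)
  qed (rule conjugate_grad_deriv)
  then show ?thesis by (simp only: s)
qed

lemma conjugate_grad_continuous: "continuous_on (dual_interval J H) (conjugate_grad J H)"
  by (rule DERIV_continuous_on[OF has_field_derivative_at_within[OF conjugate_grad_DERIV]])

lemma conjugate_eq:
  assumes "u \<in> dual_interval J H"
  shows "conjugate J H u = u * conjugate_grad J H u - H (conjugate_grad J H u)"
  using conjugate_deriv[OF conjugate_grad_mem[OF assms]] deriv_conjugate_grad[OF assms] by simp

text \<open>In the derivative of \<open>v * ?g v - H (?g v)\<close> the terms with the derivative of
  \<open>?g\<close> cancel, because \<open>deriv H (?g u) = u\<close>.\<close>

lemma conjugate_DERIV:
  assumes u: "u \<in> dual_interval J H"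
  shows "DERIV (conjugate J H) u :> conjugate_grad J H u"
proof -
  let ?g = "conjugate_grad J H"
  let ?D = "inverse (deriv (deriv H) (?g u))"
  have "DERIV H (?g u) :> u"
    using generator_DERIV[OF conjugate_grad_mem[OF u]] deriv_conjugate_grad[OF u] by simp
  then have "DERIV (\<lambda>v. H (?g v)) u :> u * ?D"
    using DERIV_chain2 conjugate_grad_DERIV[OF u] by blast
  then have "DERIV (\<lambda>v. v * ?g v - H (?g v)) u :> ?g u"
    by (auto intro!: derivative_eq_intros conjugate_grad_DERIV[OF u])
  then show ?thesis
    by (rule has_field_derivative_transform_within_open[OF _ dual_interval_open u])
      (simp add: conjugate_eq)
qed

lemma deriv_conjugate: "u \<in> dual_interval J H \<Longrightarrow> deriv (conjugate J H) u = conjugate_grad J H u"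
  by (rule DERIV_imp_deriv[OF conjugate_DERIV])

lemma deriv_mem_dual: "s \<in> J \<Longrightarrow> deriv H s \<in> dual_interval J H"
  by (simp add: dual_interval_def)

lemma deriv_conjugate_deriv: "s \<in> J \<Longrightarrow> deriv (conjugate J H) (deriv H s) = s"
  by (simp add: deriv_conjugate conjugate_grad_deriv deriv_mem_dual)

text \<open>By Fenchel equality both sides equal
  \<open>H s + conjugate J H (deriv H t) - s * deriv H t\<close>.\<close>

lemma breg_conjugate:
  assumes "s \<in> J" "t \<in> J"
  shows "breg H s t = breg (conjugate J H) (deriv H t) (deriv H s)"
  using assms unfolding breg_def by (simp add: conjugate_deriv deriv_conjugate_deriv algebra_simps)

lemma DERIV_deriv_conjugate:
  assumes "u \<in> dual_interval J H"
  shows "DERIV (deriv (conjugate J H)) u :> inverse (deriv (deriv H) (conjugate_grad J H u))"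
  by (rule has_field_derivative_transform_within_open
      [OF conjugate_grad_DERIV[OF assms] dual_interval_open assms])
    (simp add: deriv_conjugate)

text \<open>Closure under conjugation allows every result of the locale to be applied to the
  conjugate as well.\<close>

lemma generator_conjugate: "generator (dual_interval J H) (conjugate J H)"
  unfolding generator_def
proof (intro conjI ballI)
  let ?I = "dual_interval J H" and ?F = "conjugate J H" and ?g = "conjugate_grad J H"
  show "open ?I" by (rule dual_interval_open)
  have "connected J" using generator_convex convex_connected by blast
  then have "connected ?I"
    unfolding dual_interval_def by (intro connected_continuous_image generator_deriv_continuous)
  then show int: "is_interval ?I" by (simp add: is_interval_connected_1)
  show "?I \<noteq> {}" using gen by (auto simp: generator_def dual_interval_def)
  show "?F differentiable (at u)" if "u \<in> ?I" for u
    using conjugate_DERIV[OF that] real_differentiable_def by blast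
  show "deriv ?F differentiable (at u)" if "u \<in> ?I" for u
    using DERIV_deriv_conjugate[OF that] real_differentiable_def by blast
  have D2: "deriv (deriv ?F) u = inverse (deriv (deriv H) (?g u))" if "u \<in> ?I" for u
    by (rule DERIV_imp_deriv[OF DERIV_deriv_conjugate[OF that]])
  show "deriv (deriv ?F) u > 0" if "u \<in> ?I" for u
    using D2 that generator_deriv2_pos conjugate_grad_mem by auto
  \<comment> \<open>The second derivative of \<open>?F\<close> is the reciprocal of that of
    \<open>H\<close>, taken along the continuous map \<open>?g\<close>.\<close>
  have "continuous_on J (deriv (deriv H))" using gen by (simp add: generator_def)
  then have "continuous_on ?I (\<lambda>u. deriv (deriv H) (?g u))"
    by (rule continuous_on_compose2[OF _ conjugate_grad_continuous])
      (auto simp: conjugate_grad_mem)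
  then have "continuous_on ?I (\<lambda>u. inverse (deriv (deriv H) (?g u)))"
    using generator_deriv2_pos[OF conjugate_grad_mem]
    by (intro continuous_on_inverse ballI) (auto simp: less_le)
  then show "continuous_on ?I (deriv (deriv ?F))"
    by (rule continuous_on_cong[THEN iffD1, rotated -1]) (auto simp: D2)
  \<comment> \<open>Strict convexity is read off the divergence: \<open>breg ?F u v\<close> equals
    \<open>breg H (?g v) (?g u)\<close>.\<close>
  show "strictly_convex_on ?I ?F"
  proof (rule strictly_convex_on_if_breg_pos)
    show "convex ?I" using int by (simp add: is_interval_convex_1)
    fix u v assume "u \<in> ?I" "v \<in> ?I" "u \<noteq> v"
    then show "breg ?F u v > 0"
      using breg_conjugate[of "?g v" "?g u"] breg_pos[of "?g v" "?g u"]
        conjugate_grad_mem[of u] conjugate_grad_mem[of v]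
        deriv_conjugate_grad[of u] deriv_conjugate_grad[of v] by fastforce
  qed
qed

lemma dual_interval_conjugate: "dual_interval (dual_interval J H) (conjugate J H) = J"
proof -
  have "dual_interval (dual_interval J H) (conjugate J H) =
      (\<lambda>s. deriv (conjugate J H) (deriv H s)) ` J"
    by (simp add: dual_interval_def image_image)
  also have "\<dots> = J" by (simp add: deriv_conjugate_deriv)
  finally show ?thesis .
qed

text \<open>Outside \<^term>\<open>dual_interval J H\<close> the choice in \<^const>\<open>inv_into\<close> is from the empty predicate,
  hence constant, so measurability holds on the whole line.\<close>

lemma conjugate_grad_measurable: "conjugate_grad J H \<in> borel_measurable borel"
proof -
  have "conjugate_grad J H u = (SOME x. False)" if "u \<notin> dual_interval J H" for u
    using that unfolding conjugate_grad_def inv_into_def dual_interval_def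
    by (intro arg_cong[of _ _ Eps]) auto
  then have "conjugate_grad J H =
      (\<lambda>u. if u \<in> dual_interval J H then conjugate_grad J H u else (SOME x. False))"
    by auto
  also have "\<dots> \<in> borel_measurable borel"
    using dual_interval_open conjugate_grad_continuous
    by (intro borel_measurable_continuous_on_if) auto
  finally show ?thesis .
qed

section \<open>Gradient map and divergence on measurable fields\<close>

lemma grad_mem_fields: "p \<in> fields \<mu> J \<Longrightarrow> grad \<mu> H p \<in> fields \<mu> (dual_interval J H)"
proof -
  assume p: "p \<in> fields \<mu> J"
  have "(\<lambda>\<xi>. deriv H (p \<xi>)) \<in> borel_measurable \<mu>"
    by (rule measurable_continuous_compose_fields[OF generator_open generator_deriv_continuous p])
  then have "grad \<mu> H p \<in> borel_measurable \<mu>"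
    by (rule measurable_cong[THEN iffD1, rotated]) (auto simp: compose_def)
  with p show ?thesis
    by (auto simp: fields_def compose_def intro!: deriv_mem_dual)
qed

text \<open>Equality holds at every argument, not only on the space, because both sides are
  extensional.\<close>

lemma grad_conjugate_grad:
  assumes "p \<in> fields \<mu> J" shows "grad \<mu> (conjugate J H) (grad \<mu> H p) = p"
  using assms deriv_conjugate_deriv
  by (auto simp: compose_def fields_def fun_eq_iff PiE_def extensional_def Pi_def)

lemma bregman_conjugate:
  assumes "p \<in> fields \<mu> J" "q \<in> fields \<mu> J"
  shows "bregman \<mu> H p q = bregman \<mu> (conjugate J H) (grad \<mu> H q) (grad \<mu> H p)"
  unfolding bregman_def
  by (rule nn_integral_cong)
    (use assms in \<open>auto simp: fields_def compose_def PiE_def Pi_def breg_conjugate\<close>)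

lemma breg_measurable:
  assumes p: "p \<in> fields \<mu> J" and q: "q \<in> fields \<mu> J"
  shows "(\<lambda>\<xi>. breg H (p \<xi>) (q \<xi>)) \<in> borel_measurable \<mu>"
proof -
  note m = measurable_continuous_compose_fields[OF generator_open]
  have [measurable]: "p \<in> borel_measurable \<mu>" "q \<in> borel_measurable \<mu>"
    using p q by (auto simp: fields_def)
  note [measurable] = m[OF generator_continuous p] m[OF generator_continuous q]
    m[OF generator_deriv_continuous q]
  show ?thesis unfolding breg_def by measurable
qed

subsection \<open>The projection theorem\<close>

lemma AE_breg_nonneg:
  assumes "p \<in> fields \<mu> J" "q \<in> fields \<mu> J"
  shows "AE \<xi> in \<mu>. 0 \<le> breg H (p \<xi>) (q \<xi>)"
  using assms by (intro AE_I2) (auto simp: fields_def intro!: breg_nonneg)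

lemma integrable_breg:
  assumes "p \<in> fields \<mu> J" "q \<in> fields \<mu> J" "bregman \<mu> H p q < \<infinity>"
  shows "integrable \<mu> (\<lambda>\<xi>. breg H (p \<xi>) (q \<xi>))"
  by (rule integrableI_nonneg[OF breg_measurable[OF assms(1,2)] AE_breg_nonneg[OF assms(1,2)]])
    (use assms(3) in \<open>simp add: bregman_def\<close>)

lemma bregman_eq_integral:
  assumes "p \<in> fields \<mu> J" "q \<in> fields \<mu> J" "integrable \<mu> (\<lambda>\<xi>. breg H (p \<xi>) (q \<xi>))"
  shows "bregman \<mu> H p q = ennreal (\<integral>\<xi>. breg H (p \<xi>) (q \<xi>) \<partial>\<mu>)"
  unfolding bregman_def
  by (rule nn_integral_eq_integral[OF assms(3) AE_breg_nonneg[OF assms(1,2)]])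

text \<open>A nonnegative integrand with zero integral vanishes almost everywhere, and
  \<open>breg\<close> vanishes only on the diagonal.\<close>

lemma bregman_eq_0_imp_AE_eq:
  assumes p: "p \<in> fields \<mu> J" and q: "q \<in> fields \<mu> J" and 0: "bregman \<mu> H p q = 0"
  shows "AE \<xi> in \<mu>. p \<xi> = q \<xi>"
proof -
  have "(\<lambda>\<xi>. ennreal (breg H (p \<xi>) (q \<xi>))) \<in> borel_measurable \<mu>"
    using breg_measurable[OF p q] by simp
  then have "AE \<xi> in \<mu>. ennreal (breg H (p \<xi>) (q \<xi>)) = 0"
    using 0 unfolding bregman_def by (simp only: nn_integral_0_iff_AE)
  then show ?thesis
    using AE_space
  proof eventually_elim
    case (elim \<xi>)
    then have "p \<xi> \<in> J" "q \<xi> \<in> J" using p q by (auto simp: fields_def)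
    then show ?case using breg_pos[of "p \<xi>" "q \<xi>"] elim(1) by (auto simp: ennreal_eq_0_iff)
  qed
qed

text \<open>The cross term of the three-point identity is \<^term>\<open>l \<bullet> T \<xi> * (r \<xi> - p \<xi>)\<close>, whose integral
  vanishes because \<^term>\<open>r\<close> and \<^term>\<open>p\<close> have the same moment.\<close>

lemma bregman_pythagoras:
  assumes p: "p \<in> fields \<mu> J" and q: "q \<in> fields \<mu> J" and r: "r \<in> fields \<mu> J"
    and T: "T \<in> borel_measurable \<mu>"
    and tilt: "AE \<xi> in \<mu>. deriv H (p \<xi>) = deriv H (q \<xi>) + l \<bullet> T \<xi>"
    and mp: "has_moment \<mu> T p c" and mr: "has_moment \<mu> T r c"
    and fp: "bregman \<mu> H p q < \<infinity>" and fr: "bregman \<mu> H r q < \<infinity>"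
  shows "bregman \<mu> H r q = bregman \<mu> H r p + bregman \<mu> H p q"
proof -
  let ?d = "\<lambda>r q \<xi>. breg H (r \<xi>) (q \<xi>)" and ?c = "\<lambda>\<xi>. (r \<xi> - p \<xi>) * (l \<bullet> T \<xi>)"
  have AE: "AE \<xi> in \<mu>. ?d r p \<xi> = ?d r q \<xi> - ?d p q \<xi> - ?c \<xi>"
    using tilt
  proof eventually_elim
    case (elim \<xi>)
    then have l: "l \<bullet> T \<xi> = deriv H (p \<xi>) - deriv H (q \<xi>)" by simp
    show ?case unfolding l breg_def by (simp add: algebra_simps)
  qed
  note ip = integrable_breg[OF p q fp] and ir = integrable_breg[OF r q fr]
    and c = has_moment_diff[OF mp mr, of l]
  have i: "integrable \<mu> (\<lambda>\<xi>. ?d r q \<xi> - ?d p q \<xi> - ?c \<xi>)" using ip ir c(1) by simp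
  have m: "?d r p \<in> borel_measurable \<mu>" by (rule breg_measurable[OF r p])
  \<comment> \<open>Integrability of this divergence is inherited from the other three terms of the
    identity.\<close>
  have irp: "integrable \<mu> (?d r p)"
    using integrable_cong_AE[OF m borel_measurable_integrable[OF i] AE] i by simp
  have "(\<integral>\<xi>. ?d r p \<xi> \<partial>\<mu>) = (\<integral>\<xi>. ?d r q \<xi> \<partial>\<mu>) - (\<integral>\<xi>. ?d p q \<xi> \<partial>\<mu>)"
    using integral_cong_AE[OF m borel_measurable_integrable[OF i] AE] ip ir c by simp
  then show ?thesis
    using integral_nonneg_AE[OF AE_breg_nonneg[OF r p]] integral_nonneg_AE[OF AE_breg_nonneg[OF p q]]
    unfolding bregman_eq_integral[OF r q ir] bregman_eq_integral[OF r p irp]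
      bregman_eq_integral[OF p q ip]
    by (simp flip: ennreal_plus)
qed

section \<open>Multipliers, the dual objective and tilted densities\<close>

text \<open>The integral of \<open>?f\<close> is zero by equality of moments, while
  \<open>?f\<close> is the product of the increments of the density and of its gradient, hence
  nonnegative. So \<open>?f\<close> vanishes almost everywhere, and strict monotonicity gives equal
  densities and equal tilts.\<close>

lemma multiplier_unique:
  assumes "AE \<xi> in \<mu>. tilt H q T l \<xi> \<in> dual_interval J H" "has_moment \<mu> T (tilted J H q T l) c"
    and "AE \<xi> in \<mu>. tilt H q T l' \<xi> \<in> dual_interval J H" "has_moment \<mu> T (tilted J H q T l') c"
  shows "l' - l \<in> null_directions \<mu> T"
proof -
  let ?p = "tilted J H q T"
  let ?f = "\<lambda>\<xi>. (?p l' \<xi> - ?p l \<xi>) * ((l' - l) \<bullet> T \<xi>)"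
  have pos: "AE \<xi> in \<mu>. 0 \<le> ?f \<xi> \<and> (?f \<xi> = 0 \<longrightarrow> (l' - l) \<bullet> T \<xi> = 0)"
    using assms(1,3)
  proof eventually_elim
    case (elim \<xi>)
    have mem: "?p l \<xi> \<in> J" "?p l' \<xi> \<in> J"
      using elim conjugate_grad_mem by (auto simp: tilted_def)
    have "deriv H (?p l \<xi>) = tilt H q T l \<xi>" "deriv H (?p l' \<xi>) = tilt H q T l' \<xi>"
      using elim deriv_conjugate_grad by (auto simp: tilted_def)
    then have eq: "(l' - l) \<bullet> T \<xi> = deriv H (?p l' \<xi>) - deriv H (?p l \<xi>)"
      by (simp add: tilt_def inner_diff_left)
    show ?case
      using deriv_monotone_pos[OF mem(2,1)] unfolding eq
      by (cases "?p l' \<xi> = ?p l \<xi>") (auto simp: mult.commute)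
  qed
  have "AE \<xi> in \<mu>. 0 \<le> ?f \<xi>" using pos by eventually_elim simp
  then have "AE \<xi> in \<mu>. ?f \<xi> = 0"
    using has_moment_diff[OF assms(2,4), of "l' - l"] by (simp only: integral_nonneg_eq_0_iff_AE)
  then show ?thesis
    using pos unfolding null_directions_def mem_Collect_eq by eventually_elim simp
qed

text \<open>A null direction changes the tilt only on a null set, and its pairing with
  \<open>c\<close> is zero. Hence a maximizer may be moved into the relative interior.\<close>

lemma dual_objective_null_direction:
  assumes T: "T \<in> borel_measurable \<mu>" and m: "has_moment \<mu> T p c"
    and a: "a \<in> null_directions \<mu> T"
    and l: "l \<in> dual_params \<mu> J H q T" and la: "l + a \<in> dual_params \<mu> J H q T"
  shows "dual_objective \<mu> J H q T c (l + a) = dual_objective \<mu> J H q T c l"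
proof -
  have "AE \<xi> in \<mu>. conjugate J H (tilt H q T (l + a) \<xi>) = conjugate J H (tilt H q T l \<xi>)"
    using a unfolding null_directions_def mem_Collect_eq
    by eventually_elim (simp add: tilt_def inner_add_left)
  then have "(\<integral>\<xi>. conjugate J H (tilt H q T (l + a) \<xi>) \<partial>\<mu>) =
      (\<integral>\<xi>. conjugate J H (tilt H q T l \<xi>) \<partial>\<mu>)"
    using l la by (intro integral_cong_AE) (auto simp: dual_params_def)
  then show ?thesis
    using null_direction_inner_moment[OF T m a] by (simp add: dual_objective_def inner_add_left)
qed

lemma tilt_measurable:
  assumes "q \<in> fields \<mu> J" "T \<in> borel_measurable \<mu>"
  shows "tilt H q T l \<in> borel_measurable \<mu>"
proof -
  note [measurable] = assms(2)
    measurable_continuous_compose_fields[OF generator_open generator_deriv_continuous assms(1)]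
  have "(\<lambda>\<xi>. deriv H (q \<xi>) + l \<bullet> T \<xi>) \<in> borel_measurable \<mu>" by measurable
  then show ?thesis by (simp add: tilt_def[abs_def])
qed

lemma tilted_measurable:
  assumes "q \<in> fields \<mu> J" "T \<in> borel_measurable \<mu>"
  shows "tilted J H q T l \<in> borel_measurable \<mu>"
  unfolding tilted_def[abs_def]
  by (rule measurable_compose[OF tilt_measurable[OF assms] conjugate_grad_measurable])

text \<open>The tilted density is known to lie in \<open>J\<close> only almost everywhere and need
  not be extensional, so a representative in \<open>fields\<close> is constructed.\<close>

lemma tilted_AE_eq_field:
  assumes q: "q \<in> fields \<mu> J" and T: "T \<in> borel_measurable \<mu>"
    and "AE \<xi> in \<mu>. tilt H q T l \<xi> \<in> dual_interval J H"
  obtains p where "p \<in> fields \<mu> J" "AE \<xi> in \<mu>. p \<xi> = tilted J H q T l \<xi>"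
proof
  \<comment> \<open>Where the tilt leaves the dual interval, a null set, \<open>q\<close> serves as
    a default value in \<open>J\<close>.\<close>
  let ?p = "\<lambda>\<xi>. if tilt H q T l \<xi> \<in> dual_interval J H then tilted J H q T l \<xi> else q \<xi>"
  note [measurable] = tilt_measurable[OF q T] tilted_measurable[OF q T]
    borel_open[OF dual_interval_open]
  have [measurable]: "q \<in> borel_measurable \<mu>" using q by (simp add: fields_def)
  have "?p \<in> borel_measurable \<mu>" by measurable
  then have "restrict ?p (space \<mu>) \<in> borel_measurable \<mu>"
    by (rule measurable_cong[THEN iffD1, rotated]) simp
  moreover have "?p \<xi> \<in> J" if "\<xi> \<in> space \<mu>" for \<xi>
    using q that conjugate_grad_mem by (auto simp: tilted_def fields_def)
  ultimately show "restrict ?p (space \<mu>) \<in> fields \<mu> J"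
    by (simp add: fields_def)
  show "AE \<xi> in \<mu>. restrict ?p (space \<mu>) \<xi> = tilted J H q T l \<xi>"
    using assms(3) AE_space by eventually_elim simp
qed

text \<open>By the Fenchel identity for \<^term>\<open>p = tilted J H q T l\<close>, the divergence is a sum of three
  integrable terms.\<close>

lemma bregman_tilted_finite:
  assumes p: "p \<in> fields \<mu> J" and q: "q \<in> fields \<mu> J" and T: "T \<in> borel_measurable \<mu>"
    and eq: "AE \<xi> in \<mu>. p \<xi> = tilted J H q T l \<xi>"
    and m: "has_moment \<mu> T p c"
    and l: "l \<in> dual_params \<mu> J H q T" and 0: "0 \<in> dual_params \<mu> J H q T"
  shows "bregman \<mu> H p q < \<infinity>"
proof -
  let ?F = "conjugate J H"
  \<comment> \<open>The first term is written as a tilt by \<open>0\<close>, so that membership of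
    \<open>0\<close> in \<open>dual_params\<close> yields its integrability.\<close>
  let ?g = "\<lambda>\<xi>. ?F (tilt H q T 0 \<xi>) - ?F (tilt H q T l \<xi>) + p \<xi> * (l \<bullet> T \<xi>)"
  have "AE \<xi> in \<mu>. tilt H q T l \<xi> \<in> dual_interval J H" using l by (simp add: dual_params_def)
  then have AE: "AE \<xi> in \<mu>. breg H (p \<xi>) (q \<xi>) = ?g \<xi>"
    using eq AE_space
  proof eventually_elim
    case (elim \<xi>)
    have pq: "p \<xi> \<in> J" "q \<xi> \<in> J" using p q elim(3) by (auto simp: fields_def)
    have t: "tilt H q T l \<xi> = deriv H (p \<xi>)"
      using elim(1,2) deriv_conjugate_grad by (simp add: tilted_def)
    then have lT: "l \<bullet> T \<xi> = deriv H (p \<xi>) - deriv H (q \<xi>)" by (simp add: tilt_def)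
    have t0: "tilt H q T 0 \<xi> = deriv H (q \<xi>)" by (simp add: tilt_def)
    show ?case
      unfolding t t0 lT breg_def conjugate_deriv[OF pq(1)] conjugate_deriv[OF pq(2)]
      by (simp add: algebra_simps)
  qed
  have g: "integrable \<mu> ?g"
    using l 0 has_moment_inner(1)[OF m] by (auto simp: dual_params_def)
  have "integrable \<mu> (\<lambda>\<xi>. breg H (p \<xi>) (q \<xi>))"
    using integrable_cong_AE[OF breg_measurable[OF p q] borel_measurable_integrable[OF g] AE] g by simp
  then show ?thesis by (simp add: bregman_eq_integral[OF p q])
qed

text \<open>The gradient of the dual objective is \<open>c\<close> minus the moment of the tilted
  density, so stationarity is the moment constraint.\<close>

lemma optimal_multiplier:
  assumes T: "T \<in> borel_measurable \<mu>" and A: "projection_assumptions \<mu> J H q T c"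
  obtains l where "l \<in> dual_params \<mu> J H q T" "has_moment \<mu> T (tilted J H q T l) c"
proof -
  let ?D = "dual_params \<mu> J H q T" and ?\<Phi> = "dual_objective \<mu> J H q T c"
  obtain m where m: "has_moment \<mu> T m c"
    using A by (auto simp: projection_assumptions_def moment_family_def)
  obtain l a where l: "l \<in> ?D" "\<And>l'. l' \<in> ?D \<Longrightarrow> ?\<Phi> l' \<le> ?\<Phi> l"
    and a: "a \<in> null_directions \<mu> T" "l + a \<in> rel_interior ?D"
    using A unfolding projection_assumptions_def by blast
  have la: "l + a \<in> ?D" using a(2) rel_interior_subset by blast
  \<comment> \<open>The shift by \<open>a\<close> keeps the maximum and reaches a point where the
    gradient is available.\<close>
  have max: "?\<Phi> l' \<le> ?\<Phi> (l + a)" if "l' \<in> ?D" for l'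
    using l(2)[OF that] dual_objective_null_direction[OF T m a(1) l(1) la] by simp
  let ?e = "\<integral>\<xi>. tilted J H q T (l + a) \<xi> *\<^sub>R T \<xi> \<partial>\<mu>"
  have int: "l + a \<in> interior ?D" and i: "integrable \<mu> (\<lambda>\<xi>. tilted J H q T (l + a) \<xi> *\<^sub>R T \<xi>)"
    and d: "GDERIV ?\<Phi> (l + a) :> (c - ?e)"
    using A a(2) by (auto simp: projection_assumptions_def)
  \<comment> \<open>Maximality is used on the open interior of \<open>?D\<close>, where the
    derivative must vanish.\<close>
  have "(\<lambda>h. h \<bullet> (c - ?e)) = (\<lambda>h. 0)"
    using max interior_subset
    by (intro differential_zero_maxmin[OF int open_interior d[unfolded gderiv_def]]) blast
  \<comment> \<open>The zero functional is evaluated at \<open>c - ?e\<close> itself.\<close>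
  then have "(c - ?e) \<bullet> (c - ?e) = 0" by metis
  then have "has_moment \<mu> T (tilted J H q T (l + a)) c" using i by (simp add: has_moment_def)
  with la show thesis by (rule that)
qed

section \<open>Existence and uniqueness of the e-projection\<close>

theorem e_projection_solution_exists:
  assumes q: "q \<in> fields \<mu> J" and T: "T \<in> borel_measurable \<mu>"
    and A: "projection_assumptions \<mu> J H q T c"
  shows "\<exists>p l. e_projection_solution \<mu> J H q T c p l"
proof -
  let ?M = "moment_family \<mu> J H q T c"
  obtain l where l: "l \<in> dual_params \<mu> J H q T" and ml: "has_moment \<mu> T (tilted J H q T l) c"
    using optimal_multiplier[OF T A] .
  have tl: "AE \<xi> in \<mu>. tilt H q T l \<xi> \<in> dual_interval J H" using l by (simp add: dual_params_def)
  obtain p where p: "p \<in> fields \<mu> J" and eq: "AE \<xi> in \<mu>. p \<xi> = tilted J H q T l \<xi>"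
    using tilted_AE_eq_field[OF q T tl] .
  have pm: "p \<in> borel_measurable \<mu>" using p by (simp add: fields_def)
  have mp: "has_moment \<mu> T p c"
    using ml has_moment_cong_AE[OF pm tilted_measurable[OF q T] T eq] by simp
  have fin: "bregman \<mu> H p q < \<infinity>"
    using bregman_tilted_finite[OF p q T eq mp l] A by (simp add: projection_assumptions_def)
  have pM: "p \<in> ?M" using p mp fin by (simp add: moment_family_def)
  have tp: "AE \<xi> in \<mu>. deriv H (p \<xi>) = deriv H (q \<xi>) + l \<bullet> T \<xi>"
    using eq tl
    by eventually_elim (simp add: tilted_def deriv_conjugate_grad, simp add: tilt_def)
  have pyth: "bregman \<mu> H r q = bregman \<mu> H r p + bregman \<mu> H p q" if "r \<in> ?M" for r
    using that by (intro bregman_pythagoras[OF p q _ T tp mp _ fin]) (simp_all add: moment_family_def)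
  have "AE \<xi> in \<mu>. r \<xi> = p \<xi>" if r: "is_arg_min (\<lambda>r. bregman \<mu> H r q) (\<lambda>r. r \<in> ?M) r" for r
  proof -
    have rM: "r \<in> ?M" and "\<not> bregman \<mu> H p q < bregman \<mu> H r q"
      using r pM by (simp_all add: is_arg_min_def)
    \<comment> \<open>The Pythagorean identity at \<open>r\<close> is combined with minimality of
      \<open>r\<close> against the feasible \<open>p\<close>.\<close>
    then have "bregman \<mu> H r p + bregman \<mu> H p q \<le> bregman \<mu> H p q"
      using pyth[OF rM] by simp
    then have "bregman \<mu> H r p = 0" using fin by (rule ennreal_add_le_imp_eq_0)
    then show ?thesis
      using bregman_eq_0_imp_AE_eq[OF _ p] rM by (simp add: moment_family_def)
  qed
  \<comment> \<open>Dropping the nonnegative \<open>bregman \<mu> H r p\<close> from the identity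
    shows that no \<open>r\<close> improves on \<open>p\<close>.\<close>
  moreover have "is_arg_min (\<lambda>r. bregman \<mu> H r q) (\<lambda>r. r \<in> ?M) p"
    unfolding is_arg_min_def using pM pyth by (metis add_increasing not_less zero_le order_refl)
  moreover have "l' - l \<in> null_directions \<mu> T"
    if "AE \<xi> in \<mu>. tilt H q T l' \<xi> \<in> dual_interval J H" "has_moment \<mu> T (tilted J H q T l') c" for l'
    using multiplier_unique[OF tl ml that] .
  ultimately have "e_projection_solution \<mu> J H q T c p l"
    unfolding e_projection_solution_def e_projection_def Let_def
    using moment_family_m_flat l eq mp pyth by (intro conjI allI ballI impI) (simp_all only:)
  then show ?thesis by blast
qed

end

subsection \<open>Exchange of the two projections\<close>

context convex_generator
begin

section \<open>Biconjugation and bijectivity of the gradient map\<close>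

interpretation dual: convex_generator "dual_interval J H" "conjugate J H"
  by unfold_locales (rule generator_conjugate)

text \<open>Fenchel equality for the conjugate at \<open>deriv H s\<close> is simplified by Fenchel
  equality for \<open>H\<close> at \<open>s\<close>.\<close>

lemma conjugate_conjugate:
  assumes "s \<in> J" shows "conjugate (dual_interval J H) (conjugate J H) s = H s"
  using dual.conjugate_deriv[OF deriv_mem_dual[OF assms]] assms
  by (simp add: deriv_conjugate_deriv conjugate_deriv)

lemma conjugate_grad_conjugate:
  assumes "s \<in> J" shows "conjugate_grad (dual_interval J H) (conjugate J H) s = deriv H s"
  using dual.conjugate_grad_deriv[OF deriv_mem_dual[OF assms]] deriv_conjugate_deriv[OF assms] by simp

lemma grad_conjugate_mem_fields:
  "u \<in> fields \<mu> (dual_interval J H) \<Longrightarrow> grad \<mu> (conjugate J H) u \<in> fields \<mu> J"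
  using dual.grad_mem_fields[of u \<mu>] by (simp add: dual_interval_conjugate)

lemma grad_grad_conjugate:
  assumes "u \<in> fields \<mu> (dual_interval J H)" shows "grad \<mu> H (grad \<mu> (conjugate J H) u) = u"
  using assms deriv_conjugate deriv_conjugate_grad
  by (auto simp: compose_def fields_def fun_eq_iff PiE_def extensional_def Pi_def)

lemma bij_betw_grad: "bij_betw (grad \<mu> H) (fields \<mu> J) (fields \<mu> (dual_interval J H))"
  by (rule bij_betw_byWitness[where f' = "grad \<mu> (conjugate J H)"])
    (auto simp: grad_conjugate_grad grad_grad_conjugate grad_mem_fields grad_conjugate_mem_fields)

lemma inj_on_grad: "inj_on (grad \<mu> H) (fields \<mu> J)"
  using bij_betw_grad by (rule bij_betw_imp_inj_on)

section \<open>Transfer of flatness and of minimizers\<close>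

text \<open>The same affine class works on both sides: the dual coordinate of
  \<open>grad \<mu> H p\<close> with respect to the conjugate is \<open>p\<close> again. Injectivity
  reflects equality of the images.\<close>

lemma m_flat_iff_e_flat_grad:
  assumes "X \<subseteq> fields \<mu> J" "S \<subseteq> X"
  shows "m_flat \<mu> X S \<longleftrightarrow> e_flat \<mu> (conjugate J H) (grad \<mu> H ` X) (grad \<mu> H ` S)"
proof -
  have "grad \<mu> (conjugate J H) (grad \<mu> H p) = p" if "p \<in> X" for p
    using that assms(1) grad_conjugate_grad by blast
  then have "{y \<in> grad \<mu> H ` X. grad \<mu> (conjugate J H) y \<in> A} = grad \<mu> H ` {p \<in> X. p \<in> A}" for A
    by auto
  moreover have "grad \<mu> H ` S = grad \<mu> H ` {p \<in> X. p \<in> A} \<longleftrightarrow> S = {p \<in> X. p \<in> A}" for A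
    using assms by (intro inj_on_image_eq_iff[OF inj_on_grad]) auto
  ultimately show ?thesis by (simp add: m_flat_def e_flat_def)
qed

lemma e_flat_iff_m_flat_grad:
  assumes "X \<subseteq> fields \<mu> J" "S \<subseteq> X"
  shows "e_flat \<mu> H X S \<longleftrightarrow> m_flat \<mu> (grad \<mu> H ` X) (grad \<mu> H ` S)"
proof -
  have "{y \<in> grad \<mu> H ` X. y \<in> A} = grad \<mu> H ` {p \<in> X. grad \<mu> H p \<in> A}" for A
    by auto
  moreover have "grad \<mu> H ` S = grad \<mu> H ` {p \<in> X. grad \<mu> H p \<in> A} \<longleftrightarrow> S = {p \<in> X. grad \<mu> H p \<in> A}"
    for A
    using assms by (intro inj_on_image_eq_iff[OF inj_on_grad]) auto
  ultimately show ?thesis by (simp add: m_flat_def e_flat_def)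
qed

lemma is_arg_min_bregman_grad:
  assumes "S \<subseteq> fields \<mu> J" "q \<in> fields \<mu> J" "p \<in> fields \<mu> J"
  shows "is_arg_min (\<lambda>r. bregman \<mu> H r q) (\<lambda>r. r \<in> S) p \<longleftrightarrow>
      is_arg_min (\<lambda>y. bregman \<mu> (conjugate J H) (grad \<mu> H q) y) (\<lambda>y. y \<in> grad \<mu> H ` S) (grad \<mu> H p)"
    and "is_arg_min (\<lambda>r. bregman \<mu> H q r) (\<lambda>r. r \<in> S) p \<longleftrightarrow>
      is_arg_min (\<lambda>y. bregman \<mu> (conjugate J H) y (grad \<mu> H q)) (\<lambda>y. y \<in> grad \<mu> H ` S) (grad \<mu> H p)"
  by (rule is_arg_min_image[OF inj_on_grad assms(1,3)],
      rule bregman_conjugate[symmetric]; use assms in blast)+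

lemma e_projection_iff_m_projection_grad:
  assumes "X \<subseteq> fields \<mu> J" "S \<subseteq> X" "q \<in> fields \<mu> J" "p \<in> fields \<mu> J"
  shows "e_projection \<mu> H X q S p \<longleftrightarrow>
    m_projection \<mu> (conjugate J H) (grad \<mu> H ` X) (grad \<mu> H q) (grad \<mu> H ` S) (grad \<mu> H p)"
  using m_flat_iff_e_flat_grad[OF assms(1,2)] is_arg_min_bregman_grad(1)[of S] assms
  by (auto simp: e_projection_def m_projection_def)

lemma m_projection_iff_e_projection_grad:
  assumes "X \<subseteq> fields \<mu> J" "S \<subseteq> X" "q \<in> fields \<mu> J" "p \<in> fields \<mu> J"
  shows "m_projection \<mu> H X q S p \<longleftrightarrow>
    e_projection \<mu> (conjugate J H) (grad \<mu> H ` X) (grad \<mu> H q) (grad \<mu> H ` S) (grad \<mu> H p)"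
  using e_flat_iff_m_flat_grad[OF assms(1,2)] is_arg_min_bregman_grad(2)[of S] assms
  by (auto simp: e_projection_def m_projection_def)

section \<open>Transfer of the constraint families and of the solution\<close>

text \<open>Surjectivity onto the dual fields makes the image the full set defined by
  \<open>Q\<close>.\<close>

lemma grad_image_Collect:
  assumes "\<And>p. p \<in> fields \<mu> J \<Longrightarrow> P p \<longleftrightarrow> Q (grad \<mu> H p)"
  shows "grad \<mu> H ` {p \<in> fields \<mu> J. P p} = {u \<in> fields \<mu> (dual_interval J H). Q u}"
proof -
  have "grad \<mu> H ` {p \<in> fields \<mu> J. P p} = {u \<in> grad \<mu> H ` fields \<mu> J. Q u}"
    using assms by auto
  then show ?thesis by (simp add: bij_betw_imp_surj_on[OF bij_betw_grad])
qed

text \<open>A moment constraint on the dual coordinate becomes one on the image itself, and the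
  divergence in the finiteness condition swaps its arguments.\<close>

lemma grad_image_dual_moment_family:
  assumes "q \<in> fields \<mu> J"
  shows "grad \<mu> H ` dual_moment_family \<mu> J H q T c =
    moment_family \<mu> (dual_interval J H) (conjugate J H) (grad \<mu> H q) T c"
  unfolding dual_moment_family_def moment_family_def
  by (rule grad_image_Collect) (simp add: assms bregman_conjugate)

lemma grad_image_moment_family:
  assumes "q \<in> fields \<mu> J"
  shows "grad \<mu> H ` moment_family \<mu> J H q T c =
    dual_moment_family \<mu> (dual_interval J H) (conjugate J H) (grad \<mu> H q) T c"
  unfolding dual_moment_family_def moment_family_def
  by (rule grad_image_Collect) (simp add: assms bregman_conjugate grad_conjugate_grad)

text \<open>Each clause is pulled back along the inverse gradient map. The solution is affine in the
  multiplier since the gradient of the conjugate at \<open>q'\<close> is \<open>q\<close>.\<close>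

theorem m_projection_solution_grad_conjugate:
  fixes \<mu> q
  defines "q' \<equiv> grad \<mu> H q"
  assumes q: "q \<in> fields \<mu> J" and T: "T \<in> borel_measurable \<mu>"
    and sol: "e_projection_solution \<mu> (dual_interval J H) (conjugate J H) q' T c y l"
  shows "m_projection_solution \<mu> J H q T c (grad \<mu> (conjugate J H) y) l"
proof -
  let ?I = "dual_interval J H" and ?F = "conjugate J H"
  let ?X = "{r \<in> fields \<mu> J. bregman \<mu> H q r < \<infinity>}" and ?E = "dual_moment_family \<mu> J H q T c"
  let ?Y = "{r \<in> fields \<mu> ?I. bregman \<mu> ?F r q' < \<infinity>}" and ?M = "moment_family \<mu> ?I ?F q' T c"
  let ?p = "grad \<mu> ?F y"
  have q': "q' \<in> fields \<mu> ?I" unfolding q'_def by (rule grad_mem_fields[OF q])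
  have proj: "e_projection \<mu> ?F ?Y q' ?M y"
    and uniq: "\<And>r. e_projection \<mu> ?F ?Y q' ?M r \<Longrightarrow> AE \<xi> in \<mu>. r \<xi> = y \<xi>"
    and l: "l \<in> dual_params \<mu> ?I ?F q' T"
    and eq: "AE \<xi> in \<mu>. y \<xi> = tilted ?I ?F q' T l \<xi>"
    and my: "has_moment \<mu> T y c"
    and luniq: "\<And>l'. AE \<xi> in \<mu>. tilt ?F q' T l' \<xi> \<in> dual_interval ?I ?F \<Longrightarrow>
       has_moment \<mu> T (tilted ?I ?F q' T l') c \<Longrightarrow> l' - l \<in> null_directions \<mu> T"
    and pyth: "\<And>r. r \<in> ?M \<Longrightarrow> bregman \<mu> ?F r q' = bregman \<mu> ?F r y + bregman \<mu> ?F y q'"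
    using sol unfolding e_projection_solution_def Let_def by blast+
  have EX: "?E \<subseteq> ?X" "?X \<subseteq> fields \<mu> J" by (auto simp: dual_moment_family_def)
  have gX: "grad \<mu> H ` ?X = ?Y"
    unfolding q'_def by (rule grad_image_Collect) (simp add: q bregman_conjugate)
  have gE: "grad \<mu> H ` ?E = ?M"
    unfolding q'_def by (rule grad_image_dual_moment_family[OF q])
  \<comment> \<open>Stated for all \<open>r\<close> in \<open>fields\<close>, so that existence and
    uniqueness both transfer.\<close>
  have transfer: "m_projection \<mu> H ?X q ?E r \<longleftrightarrow> e_projection \<mu> ?F ?Y q' ?M (grad \<mu> H r)"
    if "r \<in> fields \<mu> J" for r
    by (rule m_projection_iff_e_projection_grad[OF EX(2,1) q that, folded q'_def, unfolded gX gE])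
  have yM: "y \<in> ?M" using proj by (simp add: e_projection_def is_arg_min_def)
  then have y: "y \<in> fields \<mu> ?I" by (simp add: moment_family_def)
  note p = grad_conjugate_mem_fields[OF y] and gp = grad_grad_conjugate[OF y]
  have mproj: "m_projection \<mu> H ?X q ?E ?p" using proj transfer[OF p] gp by simp
  have muniq: "AE \<xi> in \<mu>. r \<xi> = ?p \<xi>" if r: "m_projection \<mu> H ?X q ?E r" for r
  proof -
    have rf: "r \<in> fields \<mu> J"
      using r by (auto simp: m_projection_def is_arg_min_def dual_moment_family_def)
    have "AE \<xi> in \<mu>. grad \<mu> H r \<xi> = y \<xi>" using uniq r transfer[OF rf] by simp
    then show ?thesis
      using AE_space
    proof eventually_elim
      case (elim \<xi>)
      \<comment> \<open>\<open>?p\<close> at \<open>\<xi>\<close> depends only on the value of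
        \<open>y\<close> there, so equality of gradients can be inverted pointwise.\<close>
      have "?p \<xi> = grad \<mu> ?F (grad \<mu> H r) \<xi>"
        unfolding compose_def[of _ "deriv ?F"] using elim by simp
      then show ?case by (simp add: grad_conjugate_grad[OF rf])
    qed
  qed
  have tilt: "tilt ?F q' T l' \<xi> = q \<xi> + l' \<bullet> T \<xi>" if "\<xi> \<in> space \<mu>" for l' \<xi>
    using that q by (auto simp: tilt_def q'_def compose_def fields_def intro!: deriv_conjugate_deriv)
  have form: "AE \<xi> in \<mu>. ?p \<xi> = q \<xi> + l \<bullet> T \<xi>"
  proof -
    have "AE \<xi> in \<mu>. tilt ?F q' T l \<xi> \<in> dual_interval ?I ?F"
      using l by (simp add: dual_params_def)
    then show ?thesis
      using eq AE_space
    proof eventually_elim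
      case (elim \<xi>)
      have "?p \<xi> = deriv ?F (y \<xi>)" using elim(3) by (simp add: compose_def)
      also have "\<dots> = tilt ?F q' T l \<xi>"
        using dual.deriv_conjugate_grad[OF elim(1)] elim(2) by (simp add: tilted_def)
      finally show ?case by (simp add: tilt elim(3))
    qed
  qed
  have mult: "l' - l \<in> null_directions \<mu> T"
    if l': "AE \<xi> in \<mu>. q \<xi> + l' \<bullet> T \<xi> \<in> J"
      and m: "has_moment \<mu> T (\<lambda>\<xi>. deriv H (q \<xi> + l' \<bullet> T \<xi>)) c" for l'
  proof (rule luniq)
    show "AE \<xi> in \<mu>. tilt ?F q' T l' \<xi> \<in> dual_interval ?I ?F"
      using l' AE_space by eventually_elim (simp add: tilt dual_interval_conjugate)
    have AE: "AE \<xi> in \<mu>. deriv H (q \<xi> + l' \<bullet> T \<xi>) *\<^sub>R T \<xi> = tilted ?I ?F q' T l' \<xi> *\<^sub>R T \<xi>"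
      using l' AE_space
      by eventually_elim (simp add: tilted_def tilt conjugate_grad_conjugate)
    \<comment> \<open>Off \<open>J\<close> nothing is known of \<open>deriv H\<close>, so
      measurability of this integrand comes from its integrability.\<close>
    have i: "integrable \<mu> (\<lambda>\<xi>. deriv H (q \<xi> + l' \<bullet> T \<xi>) *\<^sub>R T \<xi>)"
      using m by (simp add: has_moment_def)
    note m1 = borel_measurable_integrable[OF i]
      and m2 = borel_measurable_scaleR[OF dual.tilted_measurable[OF q' T] T]
    show "has_moment \<mu> T (tilted ?I ?F q' T l') c"
      using m integrable_cong_AE[OF m1 m2 AE] integral_cong_AE[OF m1 m2 AE]
      by (simp add: has_moment_def)
  qed
  have "bregman \<mu> H q r = bregman \<mu> H ?p r + bregman \<mu> H q ?p" if "r \<in> ?E" for r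
  proof -
    have r: "r \<in> fields \<mu> J" using that EX by blast
    have "grad \<mu> H r \<in> ?M" using that gE by blast
    \<comment> \<open>The identity for the conjugate at \<open>grad \<mu> H r\<close> is read back
      with the arguments of each divergence swapped.\<close>
    from pyth[OF this] show ?thesis
      using r p q by (simp add: bregman_conjugate gp q'_def)
  qed
  then show ?thesis
    unfolding m_projection_solution_def Let_def
    using mproj muniq form my gp mult by auto
qed

end

theorem proposition1:
  fixes \<mu> :: "'x measure" and I I' :: "real set" and G F :: "real \<Rightarrow> real"
    and p0 :: "'x \<Rightarrow> real" and T :: "'x \<Rightarrow> real ^ 'k" and c :: "real ^ 'k"
  assumes "sigma_finite_measure \<mu>"
    and "generator I G"
    and "I' = dual_interval I G"
    and "F = conjugate I G"
    and "p0 \<in> fields \<mu> I"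
    and "T \<in> borel_measurable \<mu>"
  shows "
    \<comment> \<open>conjugation is an involution on generators, and the gradient maps are mutually inverse\<close>
    (generator I' F \<and> dual_interval I' F = I \<and>
     (\<forall>s\<in>I. conjugate I' F s = G s) \<and>
     (\<forall>u\<in>I'. deriv F u = conjugate_grad I G u) \<and>
     (\<forall>s\<in>I. deriv G s = conjugate_grad I' F s) \<and>
     bij_betw (grad \<mu> G) (fields \<mu> I) (fields \<mu> I')) \<and>
    \<comment> \<open>the divergence identity, pointwise and integrated\<close>
    (\<forall>s\<in>I. \<forall>t\<in>I. breg G s t = breg F (deriv G t) (deriv G s)) \<and>
    (\<forall>p\<in>fields \<mu> I. \<forall>q\<in>fields \<mu> I. bregman \<mu> G p q = bregman \<mu> F (grad \<mu> G q) (grad \<mu> G p)) \<and>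
    \<comment> \<open>equivalence of the two minimization problems\<close>
    (\<forall>p\<in>fields \<mu> I.
       is_arg_min (\<lambda>r. bregman \<mu> G r p0) (\<lambda>r. r \<in> moment_family \<mu> I G p0 T c) p \<longleftrightarrow>
       is_arg_min (\<lambda>\<eta>. bregman \<mu> F (grad \<mu> G p0) \<eta>)
         (\<lambda>\<eta>. \<eta> \<in> grad \<mu> G ` moment_family \<mu> I G p0 T c) (grad \<mu> G p)) \<and>
    ((INF r\<in>moment_family \<mu> I G p0 T c. bregman \<mu> G r p0) =
     (INF \<eta>\<in>grad \<mu> G ` moment_family \<mu> I G p0 T c. bregman \<mu> F (grad \<mu> G p0) \<eta>)) \<and>
    \<comment> \<open>exchange of the labels: flatness and projections\<close>
    (\<forall>X S. X \<subseteq> fields \<mu> I \<and> S \<subseteq> X \<longrightarrow>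
       (m_flat \<mu> X S \<longleftrightarrow> e_flat \<mu> F (grad \<mu> G ` X) (grad \<mu> G ` S)) \<and>
       (e_flat \<mu> G X S \<longleftrightarrow> m_flat \<mu> (grad \<mu> G ` X) (grad \<mu> G ` S))) \<and>
    (\<forall>X S. \<forall>q\<in>fields \<mu> I. \<forall>p\<in>fields \<mu> I. X \<subseteq> fields \<mu> I \<and> S \<subseteq> X \<longrightarrow>
       (e_projection \<mu> G X q S p \<longleftrightarrow>
        m_projection \<mu> F (grad \<mu> G ` X) (grad \<mu> G q) (grad \<mu> G ` S) (grad \<mu> G p)) \<and>
       (m_projection \<mu> G X q S p \<longleftrightarrow>
        e_projection \<mu> F (grad \<mu> G ` X) (grad \<mu> G q) (grad \<mu> G ` S) (grad \<mu> G p))) \<and>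
    \<comment> \<open>the constraint families of the projection theorem and of its conjugate version\<close>
    (m_flat \<mu> {p \<in> fields \<mu> I. bregman \<mu> G p p0 < \<infinity>} (moment_family \<mu> I G p0 T c)) \<and>
    (e_flat \<mu> G {p \<in> fields \<mu> I. bregman \<mu> G p0 p < \<infinity>} (dual_moment_family \<mu> I G p0 T c)) \<and>
    (grad \<mu> G ` dual_moment_family \<mu> I G p0 T c = moment_family \<mu> I' F (grad \<mu> G p0) T c) \<and>
    (grad \<mu> G ` moment_family \<mu> I G p0 T c = dual_moment_family \<mu> I' F (grad \<mu> G p0) T c) \<and>
    \<comment> \<open>the projection theorem for G, and its application to F, which gives the m-projection\<close>
    (projection_assumptions \<mu> I G p0 T c \<longrightarrow>
       (\<exists>p l. e_projection_solution \<mu> I G p0 T c p l)) \<and>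
    (projection_assumptions \<mu> I' F (grad \<mu> G p0) T c \<longrightarrow>
       (\<exists>\<eta> l. e_projection_solution \<mu> I' F (grad \<mu> G p0) T c \<eta> l \<and>
              m_projection_solution \<mu> I G p0 T c (grad \<mu> F \<eta>) l))"
proof -
  interpret G: convex_generator I G
    by unfold_locales (rule assms(2))
  \<comment> \<open>The second instance makes the same existence theorem available for the conjugate
    generator.\<close>
  interpret F: convex_generator "dual_interval I G" "conjugate I G"
    by unfold_locales (rule G.generator_conjugate)
  note p0 = assms(5) and T = assms(6)
  have M: "moment_family \<mu> I G p0 T c \<subseteq> fields \<mu> I" by (auto simp: moment_family_def)
  \<comment> \<open>The infima agree term by term after reindexing, whether or not they are
    attained.\<close>
  have INF: "(INF r\<in>moment_family \<mu> I G p0 T c. bregman \<mu> G r p0) =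
      (INF y\<in>grad \<mu> G ` moment_family \<mu> I G p0 T c. bregman \<mu> (conjugate I G) (grad \<mu> G p0) y)"
    unfolding image_image
    by (intro INF_cong refl G.bregman_conjugate p0 subsetD[OF M])
  have solF: "\<exists>y l. e_projection_solution \<mu> (dual_interval I G) (conjugate I G) (grad \<mu> G p0) T c y l \<and>
      m_projection_solution \<mu> I G p0 T c (grad \<mu> (conjugate I G) y) l"
    if "projection_assumptions \<mu> (dual_interval I G) (conjugate I G) (grad \<mu> G p0) T c"
    using F.e_projection_solution_exists[OF G.grad_mem_fields[OF p0] T that]
      G.m_projection_solution_grad_conjugate[OF p0 T] by blast
  show ?thesis
    unfolding assms(3,4)
    by (intro conjI ballI allI impI G.generator_conjugate G.dual_interval_conjugate
        G.conjugate_conjugate G.deriv_conjugate G.conjugate_grad_conjugate[symmetric]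
        G.bij_betw_grad G.breg_conjugate G.bregman_conjugate
        G.is_arg_min_bregman_grad(1)[OF M p0] INF
        G.m_flat_iff_e_flat_grad G.e_flat_iff_m_flat_grad
        G.e_projection_iff_m_projection_grad G.m_projection_iff_e_projection_grad
        moment_family_m_flat dual_moment_family_e_flat
        G.grad_image_dual_moment_family[OF p0] G.grad_image_moment_family[OF p0]
        G.e_projection_solution_exists[OF p0 T] solF)
      blast+
qed

end
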